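(* Let $G$ be a nontrivial connected graph of order $n$. Then $spvc(G)=n-3$ if and only if $G$ is isomorphic to one of the following twelve graphs: (1) the triangle $K_3$; (2) the star $K_{1,3}$; (3) the cycle $C_4$; (4) the graph obtained from a triangle by attaching one pendant vertex to one of its vertices; (5) $K_4$ minus an edge; (6) the path $P_5$ on five vertices; (7) the tree obtained from $K_{1,3}$ by subdividing one edge once; (8) the graph obtained from a triangle by attaching one pendant vertex to each of two of its vertices; (9) the graph obtained from a triangle by joining one of its vertices by an edge to an end-vertex of a disjoint path on two vertices; (10) the graph obtained from $C_4$ by attaching one pendant vertex to one of its vertices; (11) the graph obtained from $K_4$ minus an edge by attaching one pendant vertex to one of its vertices of degree $2$; (12) the graph of order $6$ obtained from a triangle by attaching one pendant vertex to each of its three vertices.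
   Context: All graphs are simple, finite and undirected; nontrivial means having at least two vertices; the order of a graph is its number of vertices. Attaching a pendant vertex to a vertex $x$ means adding a new vertex adjacent only to $x$. Vertex-colorings are arbitrary (adjacent vertices may receive the same color). A path in a vertex-colored graph is a vertex-proper path if any two adjacent internal vertices of the path differ in color (the end-vertices are not internal). A $u$-$v$ geodesic is a $u$-$v$ path of length $d(u,v)$. A vertex-colored graph is strong proper vertex-connected if for any two distinct vertices $u,v$ there exists a vertex-proper $u$-$v$ geodesic. For a connected graph $G$, $spvc(G)$ is the smallest number of colors required to make $G$ strong proper vertex-connected. The value $0$ is allowed: it means that no vertex needs to be colored, where an uncolored path counts as vertex-proper exactly when it has no internal vertices. *)

theory Defs
  imports Graph_Theory.Graph_Theory
begin

text \<open>
  Simple finite undirected graphs are \<^locale>\<open>pair_graph\<close>s, i.e. finite, loop-free, symmetric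
  relations; an undirected edge is a pair of opposite arcs. Paths are lists of arcs.
\<close>

text \<open>With unit arc weights, \<open>wf_digraph.\<mu>\<close> is the usual graph distance.\<close>

definition geodesic :: "'a pair_pre_digraph \<Rightarrow> 'a \<Rightarrow> ('a \<times> 'a) awalk \<Rightarrow> 'a \<Rightarrow> bool" where
  "geodesic G u p v \<longleftrightarrow>
     pre_digraph.apath (with_proj G) u p v \<and>
     ereal (real (length p)) = wf_digraph.\<mu> (with_proj G) (\<lambda>_. 1) u v"

text \<open>
  A coloring is \<open>Some c\<close> with \<open>c\<close> an arbitrary assignment of colors to vertices; \<open>None\<close>
  means that no vertex is colored. An uncolored path is vertex-proper iff it has no internal
  vertices.
\<close>

primrec vertex_proper ::
    "'a pair_pre_digraph \<Rightarrow> ('a \<Rightarrow> nat) option \<Rightarrow> ('a \<times> 'a) awalk \<Rightarrow> bool" where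
  "vertex_proper G None p \<longleftrightarrow> pre_digraph.inner_verts (with_proj G) p = []"
| "vertex_proper G (Some c) p \<longleftrightarrow> distinct_adj (map c (pre_digraph.inner_verts (with_proj G) p))"

primrec num_colors :: "'a pair_pre_digraph \<Rightarrow> ('a \<Rightarrow> nat) option \<Rightarrow> nat" where
  "num_colors G None = 0"
| "num_colors G (Some c) = card (c ` pverts G)"

definition strong_proper_vertex_connected ::
    "'a pair_pre_digraph \<Rightarrow> ('a \<Rightarrow> nat) option \<Rightarrow> bool" where
  "strong_proper_vertex_connected G col \<longleftrightarrow>
     (\<forall>u \<in> pverts G. \<forall>v \<in> pverts G. u \<noteq> v \<longrightarrow>
        (\<exists>p. geodesic G u p v \<and> vertex_proper G col p))"

definition spvc :: "'a pair_pre_digraph \<Rightarrow> nat" where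
  "spvc G = (LEAST k. \<exists>col. num_colors G col = k \<and> strong_proper_vertex_connected G col)"

definition graph_of_edges :: "nat \<Rightarrow> (nat \<times> nat) list \<Rightarrow> nat pair_pre_digraph" where
  "graph_of_edges n es = \<lparr> pverts = {..<n}, parcs = set es \<union> (set es)\<inverse> \<rparr>"

definition K3 :: "nat pair_pre_digraph" where
  "K3 = graph_of_edges 3 [(0,1), (1,2), (2,0)]"

definition K13 :: "nat pair_pre_digraph" where
  "K13 = graph_of_edges 4 [(0,1), (0,2), (0,3)]"

definition C4 :: "nat pair_pre_digraph" where
  "C4 = graph_of_edges 4 [(0,1), (1,2), (2,3), (3,0)]"

text \<open>Triangle 0, 1, 2 with a pendant vertex at 0.\<close>
definition paw :: "nat pair_pre_digraph" where
  "paw = graph_of_edges 4 [(0,1), (1,2), (2,0), (0,3)]"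

text \<open>\<open>K\<^sub>4\<close> without the edge between 1 and 3.\<close>
definition diamond :: "nat pair_pre_digraph" where
  "diamond = graph_of_edges 4 [(0,1), (0,2), (0,3), (1,2), (2,3)]"

definition P5 :: "nat pair_pre_digraph" where
  "P5 = graph_of_edges 5 [(0,1), (1,2), (2,3), (3,4)]"

text \<open>\<open>K\<^sub>1\<^sub>,\<^sub>3\<close> with center 0, the third edge being subdivided by the vertex 3.\<close>
definition fork :: "nat pair_pre_digraph" where
  "fork = graph_of_edges 5 [(0,1), (0,2), (0,3), (3,4)]"

text \<open>Triangle 0, 1, 2 with pendant vertices at 0 and at 1.\<close>
definition bull :: "nat pair_pre_digraph" where
  "bull = graph_of_edges 5 [(0,1), (1,2), (2,0), (0,3), (1,4)]"

text \<open>Triangle 0, 1, 2 and path 3, 4, joined by the edge between 0 and 3.\<close>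
definition lollipop :: "nat pair_pre_digraph" where
  "lollipop = graph_of_edges 5 [(0,1), (1,2), (2,0), (0,3), (3,4)]"

text \<open>\<open>C\<^sub>4\<close> with a pendant vertex at 0.\<close>
definition banner :: "nat pair_pre_digraph" where
  "banner = graph_of_edges 5 [(0,1), (1,2), (2,3), (3,0), (0,4)]"

text \<open>The diamond above with a pendant vertex at 1, which has degree 2 there.\<close>
definition kite :: "nat pair_pre_digraph" where
  "kite = graph_of_edges 5 [(0,1), (0,2), (0,3), (1,2), (2,3), (1,4)]"

text \<open>Triangle 0, 1, 2 with a pendant vertex at each of its vertices.\<close>
definition net :: "nat pair_pre_digraph" where
  "net = graph_of_edges 6 [(0,1), (1,2), (2,0), (0,3), (1,4), (2,5)]"

end

theory Submission
  imports Defs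
begin

text \<open>
  Call an edge \<open>ab\<close> a middle edge if \<open>x a b y\<close> is a geodesic for some \<open>x\<close> and \<open>y\<close>. A coloring that
  is proper on the middle edges makes every geodesic vertex-proper, so \<open>spvc G\<close> is at most the
  chromatic number of the graph of middle edges.

  Let \<open>S\<close> be a minimal set of vertices on which that graph is not \<open>k\<close>-colorable, where
  \<open>n \<le> k + 4\<close>. Its vertices have degree at least \<open>k\<close> in \<open>S\<close>, so \<open>|S| > k\<close>. If \<open>|S| = k + 1\<close> then
  \<open>S\<close> is a clique, and the neighborhoods of its vertices in the complement (at most three vertices)
  form an antichain; this forces \<open>k \<le> 2\<close>, and the net if \<open>n = 6\<close>. Minimality excludes
  \<open>|S| = k + 2\<close>. Otherwise at most one vertex \<open>w\<close> lies outside \<open>S\<close>. The ends \<open>x\<close>, \<open>y\<close> above have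
  disjoint closed neighborhoods, so for \<open>n < 2 (k + 1)\<close> they are not both in \<open>S\<close>; hence one of them
  is \<open>w\<close>, and adjacency to \<open>w\<close> is a 2-coloring of \<open>S\<close>; for \<open>n = 6\<close> and \<open>k = 2\<close> they are both in
  \<open>S\<close> only in the hexagon, which is bipartite. With \<open>k = n - 4\<close> this gives
  \<open>spvc G \<le> n - 4\<close> for \<open>n \<ge> 7\<close>. For \<open>n \<le> 5\<close> it remains to use that \<open>spvc G = 0\<close> and \<open>spvc G \<le> 1\<close>
  characterize the complete graphs and those of diameter at most 2.
\<close>

section \<open>Geodesics and middle edges\<close>

definition within2 :: "'a pair_pre_digraph \<Rightarrow> 'a \<Rightarrow> 'a \<Rightarrow> bool" where
  "within2 G u v \<longleftrightarrow>
     u = v \<or> (u, v) \<in> parcs G \<or> (\<exists>w. (u, w) \<in> parcs G \<and> (w, v) \<in> parcs G)"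

text \<open>With the common neighbor bounded by the arc set, the relation can be decided by
  simplification on an explicitly listed graph.\<close>

lemma within2_Bex:
  "within2 G u v \<longleftrightarrow>
     u = v \<or> (u, v) \<in> parcs G \<or> (\<exists>e \<in> parcs G. fst e = u \<and> (snd e, v) \<in> parcs G)"
  unfolding within2_def by force

text \<open>Distance exactly three, without reference to walks. In a loop-free graph the four
  vertices are then distinct, since any coincidence would leave x and y within distance two.\<close>

definition geodesic3 :: "'a pair_pre_digraph \<Rightarrow> 'a \<Rightarrow> 'a \<Rightarrow> 'a \<Rightarrow> 'a \<Rightarrow> bool" where
  "geodesic3 G x a b y \<longleftrightarrow>
     (x, a) \<in> parcs G \<and> (a, b) \<in> parcs G \<and> (b, y) \<in> parcs G \<and> \<not> within2 G x y"

definition middle_edge :: "'a pair_pre_digraph \<Rightarrow> 'a \<Rightarrow> 'a \<Rightarrow> bool" where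
  "middle_edge G a b \<longleftrightarrow> (\<exists>x y. geodesic3 G x a b y)"

definition colorable :: "('a \<Rightarrow> 'a \<Rightarrow> bool) \<Rightarrow> 'a set \<Rightarrow> nat \<Rightarrow> bool" where
  "colorable E S k \<longleftrightarrow>
     (\<exists>c :: 'a \<Rightarrow> nat. c ` S \<subseteq> {..<k} \<and> (\<forall>u \<in> S. \<forall>v \<in> S. E u v \<longrightarrow> c u \<noteq> c v))"

lemma colorableI:
  assumes "c ` S \<subseteq> {..<k}" "\<And>u v. u \<in> S \<Longrightarrow> v \<in> S \<Longrightarrow> E u v \<Longrightarrow> c u \<noteq> c v"
  shows "colorable E S k"
  using assms unfolding colorable_def by (intro exI[of _ c]) simp

lemma colorableE:
  assumes "colorable E S k"
  obtains c :: "'a \<Rightarrow> nat" where "c ` S \<subseteq> {..<k}"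
    "\<And>u v. u \<in> S \<Longrightarrow> v \<in> S \<Longrightarrow> E u v \<Longrightarrow> c u \<noteq> c v"
  using assms unfolding colorable_def by metis

context pair_graph
begin

lemma arc_sym: "(u, v) \<in> parcs G \<longleftrightarrow> (v, u) \<in> parcs G"
  using arcs_symmetric by blast

section \<open>Geodesics as shortest walks\<close>

lemma awalk_cost_unit: "awalk_cost (\<lambda>_. 1) p = real (length p)"
  by (induction p) auto

text \<open>With unit weights \<open>\<mu>\<close> is the infimum of the walk lengths, so a geodesic
  may be compared with arbitrary walks; the shortcuts built below need not be paths.\<close>

lemma geodesic_iff:
  "geodesic G u p v \<longleftrightarrow> apath u p v \<and> (\<forall>q. awalk u q v \<longrightarrow> length p \<le> length q)"
proof
  assume g: "geodesic G u p v"
  show "apath u p v \<and> (\<forall>q. awalk u q v \<longrightarrow> length p \<le> length q)"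
    using g min_cost_le_walk_cost[of u _ v "\<lambda>_. 1"]
    unfolding geodesic_def awalk_cost_unit by (metis ereal_less_eq(3) of_nat_le_iff)
next
  assume g: "apath u p v \<and> (\<forall>q. awalk u q v \<longrightarrow> length p \<le> length q)"
  then have "\<mu> (\<lambda>_. 1) u v = ereal (real (length p))"
    unfolding \<mu>_def awalk_cost_unit
    by (intro antisym INF_greatest INF_lower2[of p]) (auto intro: awalkI_apath)
  with g show "geodesic G u p v" unfolding geodesic_def by simp
qed

lemma geodesic_exists:
  assumes "connected G" "u \<in> pverts G" "v \<in> pverts G"
  obtains p where "geodesic G u p v"
proof -
  have "u \<rightarrow>\<^sup>*\<^bsub>with_proj G\<^esub> v"
    using assms symmetric_connected_imp_strongly_connected[OF sym_arcs]
    by (auto simp: strongly_connected_def)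
  from min_cost_awalk[OF this, of "\<lambda>_. 1"]
  obtain p where "apath u p v" "\<mu> (\<lambda>_. 1) u v = awalk_cost (\<lambda>_. 1) p" by auto
  then show ?thesis using that unfolding geodesic_def awalk_cost_unit by simp
qed

text \<open>If x and y were within distance two, the three arcs could be replaced by at most two,
  giving a shorter walk from u to v. The separate names a' and b' let any three arcs of a list
  match; the walk forces a' = a and b' = b.\<close>

lemma geodesic_imp_geodesic3:
  assumes "geodesic G u (p1 @ (x, a) # (a', b) # (b', y) # p2) v"
  shows "geodesic3 G x a b y"
proof -
  let ?p = "p1 @ (x, a) # (a', b) # (b', y) # p2"
  from assms have w: "awalk u ?p v" and short: "\<And>q. awalk u q v \<Longrightarrow> length ?p \<le> length q"
    unfolding geodesic_iff apath_def by blast+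
  from w have arcs: "(x, a) \<in> parcs G" "(a, b) \<in> parcs G" "(b, y) \<in> parcs G"
    and w1: "awalk u p1 x" and w2: "awalk y p2 v"
    by (auto simp: awalk_simps)
  have "\<not> within2 G x y"
  proof
    assume "within2 G x y"
    then consider "x = y" | "(x, y) \<in> parcs G"
      | z where "(x, z) \<in> parcs G" "(z, y) \<in> parcs G" unfolding within2_def by blast
    then show False
    proof cases
      case 1 then show False using short[OF awalk_appendI[OF w1, of p2]] w2 by simp
    next
      case 2 then show False
        using short[OF awalk_appendI[OF w1, of "(x, y) # p2"]] w2 by (simp add: awalk_simps)
    next
      case 3 then show False
        using short[OF awalk_appendI[OF w1, of "(x, z) # (z, y) # p2"]] w2 by (simp add: awalk_simps)
    qed
  qed
  with arcs show ?thesis unfolding geodesic3_def by blast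
qed

text \<open>Two consecutive internal vertices are the ends of the middle one of three consecutive
  arcs, hence of a middle edge.\<close>

lemma geodesic_vertex_proper:
  assumes c: "\<And>a b. middle_edge G a b \<Longrightarrow> c a \<noteq> c b"
    and g: "geodesic G u p v"
  shows "vertex_proper G (Some c) p"
proof -
  \<comment> \<open>The internal vertices are the tails of all arcs but the first, so consecutive
    ones sit at \<open>Suc i\<close> and \<open>Suc (Suc i)\<close>.\<close>
  have "c (fst (p ! Suc i)) \<noteq> c (fst (p ! Suc (Suc i)))" if "Suc (Suc i) < length p" for i
  proof -
    have split: "p = take i p @ p ! i # p ! Suc i # p ! Suc (Suc i) # drop (Suc (Suc (Suc i))) p"
      using that by (simp add: Cons_nth_drop_Suc)
    have w: "awalk u p v" using g by (auto simp: geodesic_iff apath_def)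
    have "snd (p ! Suc i) = fst (p ! Suc (Suc i))" "snd (p ! i) = fst (p ! Suc i)"
      using w by (subst (asm) split, auto simp: awalk_simps)+
    moreover have "geodesic3 G (fst (p ! i)) (snd (p ! i)) (snd (p ! Suc i)) (snd (p ! Suc (Suc i)))"
      using g by (intro geodesic_imp_geodesic3[of u "take i p" _ _ "fst (p ! Suc i)" _
          "fst (p ! Suc (Suc i))" _ "drop (Suc (Suc (Suc i))) p" v]) (simp flip: split)
    ultimately show ?thesis using c unfolding middle_edge_def by metis
  qed
  then show ?thesis
    by (auto simp: inner_verts_def distinct_adj_conv_nth nth_tl)
qed

lemma spvc_le_colorable:
  assumes "connected G" "colorable (middle_edge G) (pverts G) k"
  shows "spvc G \<le> k"
proof -
  obtain c where c: "c ` pverts G \<subseteq> {..<k}"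
    and proper: "\<And>u v. u \<in> pverts G \<Longrightarrow> v \<in> pverts G \<Longrightarrow> middle_edge G u v \<Longrightarrow> c u \<noteq> c v"
    using colorableE[OF assms(2)] by metis
  have "strong_proper_vertex_connected G (Some c)"
    unfolding strong_proper_vertex_connected_def
  proof (intro ballI impI)
    fix u v assume "u \<in> pverts G" "v \<in> pverts G"
    then obtain p where p: "geodesic G u p v" using geodesic_exists assms(1) by blast
    have "c a \<noteq> c b" if "middle_edge G a b" for a b
      using proper[of a b] that unfolding middle_edge_def geodesic3_def
      by (meson wellformed'(1) wellformed'(2))
    then show "\<exists>p. geodesic G u p v \<and> vertex_proper G (Some c) p"
      using geodesic_vertex_proper p by blast
  qed
  then have "spvc G \<le> num_colors G (Some c)"
    unfolding spvc_def by (intro Least_le) blast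
  also have "\<dots> \<le> k" using card_mono[OF _ c] by simp
  finally show ?thesis .
qed

text \<open>An injective coloring separates the ends of every middle edge, so the
  \<open>LEAST\<close> ranges over a nonempty set.\<close>

lemma spvc_attained:
  assumes "connected G"
  obtains col where "num_colors G col = spvc G" "strong_proper_vertex_connected G col"
proof -
  obtain c :: "'a \<Rightarrow> nat" where "inj_on c (pverts G)"
    using finite_imp_inj_to_nat_seg[OF pair_finite_verts] by blast
  then have "c a \<noteq> c b" if "middle_edge G a b" for a b
    using that no_loops' unfolding middle_edge_def geodesic3_def
    by (metis inj_on_eq_iff wellformed'(1) wellformed'(2))
  then have "strong_proper_vertex_connected G (Some c)"
    unfolding strong_proper_vertex_connected_def
    using geodesic_exists[OF assms] geodesic_vertex_proper by metis
  then have "\<exists>k. \<exists>col. num_colors G col = k \<and> strong_proper_vertex_connected G col" by blast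
  from LeastI_ex[OF this] show ?thesis using that unfolding spvc_def by blast
qed

lemma geodesic_length_le2:
  assumes "geodesic G u p v" "length p \<le> 2"
  shows "within2 G u v"
proof -
  have w: "awalk u p v" using assms(1) by (auto simp: geodesic_iff apath_def)
  consider "p = []" | e where "p = [e]" | e f where "p = [e, f]"
    using assms(2) by (cases p; cases "tl p"; cases "tl (tl p)") auto
  then show ?thesis
    by cases (use w in \<open>auto simp: awalk_simps within2_def\<close>)
qed

lemma geodesic_three_arcs:
  assumes g: "geodesic G u p v" and "\<not> within2 G u v"
  obtains a b y q where "p = (u, a) # (a, b) # (b, y) # q" "geodesic3 G u a b y"
proof -
  have "length p \<ge> 3" using geodesic_length_le2[OF g] assms(2) by linarith
  then obtain e f h q where p: "p = e # f # h # q"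
    by (auto simp: numeral_3_eq_3 Suc_le_length_iff)
  obtain u' a a' b b' y where e: "e = (u', a)" "f = (a', b)" "h = (b', y)" by (metis surj_pair)
  have "awalk u p v" using g by (auto simp: geodesic_iff apath_def)
  then have "u' = u" "a' = a" "b' = b" using p e by (auto simp: awalk_simps)
  then show ?thesis using that[of a b y q] p e g geodesic_imp_geodesic3[of u "[]"] by auto
qed

text \<open>The first three arcs of a geodesic from u to v serve; y is the third vertex after u and
  need not be v.\<close>

lemma ex_geodesic3:
  assumes "connected G" "u \<in> pverts G" "v \<in> pverts G" "\<not> within2 G u v"
  obtains a b y where "geodesic3 G u a b y"
proof -
  obtain p where "geodesic G u p v" using geodesic_exists assms(1-3) .
  then show ?thesis using geodesic_three_arcs assms(4) that by blast
qed

section \<open>Graphs with value 0 and with value at most 1\<close>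

lemma complete_spvc:
  assumes "\<And>u v. u \<in> pverts G \<Longrightarrow> v \<in> pverts G \<Longrightarrow> u \<noteq> v \<Longrightarrow> (u, v) \<in> parcs G"
  shows "spvc G = 0"
proof -
  have "geodesic G u [(u, v)] v" if "u \<in> pverts G" "v \<in> pverts G" "u \<noteq> v" for u v
    using assms[OF that] that unfolding geodesic_iff
    by (auto simp: apath_simps awalk_Nil_iff Suc_le_eq)
  then have "strong_proper_vertex_connected G None"
    unfolding strong_proper_vertex_connected_def
    by (metis inner_verts_with_proj_def list.map(1,2) list.sel(3) vertex_proper.simps(1))
  then have "spvc G \<le> num_colors G None" unfolding spvc_def by (intro Least_le) blast
  then show ?thesis by simp
qed

text \<open>Zero colors on a nonempty vertex set force \<open>None\<close>; then the geodesic
  between two vertices has no internal vertex and is a single arc.\<close>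

lemma spvc_eq_0_iff:
  assumes "connected G"
  shows "spvc G = 0 \<longleftrightarrow> (\<forall>u \<in> pverts G. \<forall>v \<in> pverts G. u \<noteq> v \<longrightarrow> (u, v) \<in> parcs G)"
proof
  assume 0: "spvc G = 0"
  obtain col where col: "num_colors G col = 0" "strong_proper_vertex_connected G col"
    using spvc_attained[OF assms] 0 by metis
  show "\<forall>u \<in> pverts G. \<forall>v \<in> pverts G. u \<noteq> v \<longrightarrow> (u, v) \<in> parcs G"
  proof (intro ballI impI)
    fix u v assume uv: "u \<in> pverts G" "v \<in> pverts G" "u \<noteq> v"
    have "col = None" using col(1) uv by (cases col) auto
    then obtain p where p: "geodesic G u p v" "tl (map fst p) = []"
      using col(2) uv unfolding strong_proper_vertex_connected_def
      by (auto simp: inner_verts_def)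
    have w: "awalk u p v" using p(1) by (auto simp: geodesic_iff apath_def)
    show "(u, v) \<in> parcs G"
      using w uv p(2) by (cases p) (auto simp: awalk_simps)
  qed
qed (use complete_spvc in blast)

text \<open>The vertex-proper geodesic from x to y may avoid a and b, but it too has exactly three
  arcs, so its two internal vertices are consecutive and differ in color.\<close>

lemma geodesic3_color_neq:
  assumes "strong_proper_vertex_connected G (Some c)" "geodesic3 G x a b y"
  obtains a' b' where "geodesic3 G x a' b' y" "c a' \<noteq> c b'"
proof -
  have far: "\<not> within2 G x y" and arcs: "(x, a) \<in> parcs G" "(a, b) \<in> parcs G" "(b, y) \<in> parcs G"
    using assms(2) unfolding geodesic3_def by blast+
  have xy: "x \<in> pverts G" "y \<in> pverts G" "x \<noteq> y"
    using wellformed' arcs far unfolding within2_def by blast+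
  obtain p where p: "geodesic G x p y" "vertex_proper G (Some c) p"
    using assms(1) xy unfolding strong_proper_vertex_connected_def by blast
  \<comment> \<open>The given walk bounds the geodesic by three arcs, which leaves nothing after the
    first three.\<close>
  have "awalk x [(x, a), (a, b), (b, y)] y" using arcs xy by (simp add: awalk_simps)
  with p(1) have "length p \<le> length [(x, a), (a, b), (b, y)]" unfolding geodesic_iff by blast
  then have "length p \<le> 3" by simp
  moreover obtain a' b' y' q where q: "p = (x, a') # (a', b') # (b', y') # q"
    "geodesic3 G x a' b' y'"
    using geodesic_three_arcs[OF p(1) far] .
  ultimately have "q = []" by simp
  moreover have "awalk x p y" using p(1) by (auto simp: geodesic_iff apath_def)
  ultimately have "y' = y" using q by (auto simp: awalk_simps)
  moreover have "c a' \<noteq> c b'" using p(2) q by (simp add: inner_verts_def)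
  ultimately show ?thesis using that q by blast
qed

text \<open>Diameter at most two leaves no middle edge, so a constant coloring works; vertices
  farther apart yield a pair at distance three, whose geodesic needs two colors.\<close>

lemma spvc_le_1_iff:
  assumes "connected G"
  shows "spvc G \<le> 1 \<longleftrightarrow> (\<forall>u \<in> pverts G. \<forall>v \<in> pverts G. within2 G u v)"
proof
  assume le: "spvc G \<le> 1"
  show "\<forall>u \<in> pverts G. \<forall>v \<in> pverts G. within2 G u v"
  proof (intro ballI, rule ccontr)
    fix u v assume uv: "u \<in> pverts G" "v \<in> pverts G" and far: "\<not> within2 G u v"
    obtain a b y where aby: "geodesic3 G u a b y" using ex_geodesic3 assms uv far by metis
    obtain col where col: "num_colors G col = spvc G" "strong_proper_vertex_connected G col"
      using spvc_attained[OF assms] by metis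
    show False
    proof (cases col)
      case None
      then have "spvc G = 0" using col by simp
      then have "\<forall>u \<in> pverts G. \<forall>v \<in> pverts G. u \<noteq> v \<longrightarrow> (u, v) \<in> parcs G"
        using spvc_eq_0_iff assms by blast
      then show False using uv far unfolding within2_def by blast
    next
      case (Some c)
      obtain a' b' where ab: "geodesic3 G u a' b' y" "c a' \<noteq> c b'"
        using geodesic3_color_neq[of c] col(2) Some aby by blast
      then have "{c a', c b'} \<subseteq> c ` pverts G"
        using wellformed' unfolding geodesic3_def by blast
      then have "card {c a', c b'} \<le> card (c ` pverts G)"
        by (intro card_mono finite_imageI pair_finite_verts)
      then show False using ab col(1) Some le by simp
    qed
  qed
next
  assume "\<forall>u \<in> pverts G. \<forall>v \<in> pverts G. within2 G u v"
  then have "\<not> middle_edge G a b" for a b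
    unfolding middle_edge_def geodesic3_def using wellformed' by blast
  then have "colorable (middle_edge G) (pverts G) 1"
    by (intro colorableI[where c = "\<lambda>_. 0"]) auto
  then show "spvc G \<le> 1" using spvc_le_colorable assms by blast
qed

end

section \<open>Coloring the middle edges\<close>

text \<open>Colors may come from any type: only the number of values matters, as they can be
  renumbered. Below they are truth values or vertices.\<close>

lemma colorable_image:
  assumes "finite S" "\<And>u v. u \<in> S \<Longrightarrow> v \<in> S \<Longrightarrow> E u v \<Longrightarrow> f u \<noteq> f v" "card (f ` S) \<le> k"
  shows "colorable E S k"
proof -
  obtain g where g: "bij_betw g (f ` S) {..<card (f ` S)}"
    using ex_bij_betw_finite_nat[of "f ` S"] assms(1) by (auto simp: atLeast0LessThan)
  have "(g \<circ> f) ` S \<subseteq> {..<k}"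
    using bij_betw_imp_surj_on[OF g] assms(3) by (auto simp: image_comp)
  moreover have "(g \<circ> f) u \<noteq> (g \<circ> f) v" if "u \<in> S" "v \<in> S" "E u v" for u v
    using assms(2)[OF that] bij_betw_imp_inj_on[OF g] that by (auto simp: inj_on_eq_iff)
  ultimately show ?thesis by (rule colorableI)
qed

lemma colorable_mono: "colorable E S j \<Longrightarrow> j \<le> k \<Longrightarrow> colorable E S k"
  unfolding colorable_def image_subset_iff lessThan_iff by (meson less_le_trans)

lemma minimal_not_colorable:
  assumes "finite V" "\<not> colorable E V k"
  obtains S where "S \<subseteq> V" "\<not> colorable E S k" "\<And>v. v \<in> S \<Longrightarrow> colorable E (S - {v}) k"
proof -
  let ?P = "\<lambda>S. S \<subseteq> V \<and> \<not> colorable E S k"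
  obtain S where S: "?P S" and min: "\<And>T. ?P T \<Longrightarrow> card S \<le> card T"
    using ex_has_least_nat[of ?P V card] assms(2) by blast
  have "colorable E (S - {v}) k" if "v \<in> S" for v
  proof (rule ccontr)
    assume "\<not> colorable E (S - {v}) k"
    then have "card S \<le> card (S - {v})" using min[of "S - {v}"] S by blast
    moreover have "finite S" using S assms(1) finite_subset by blast
    ultimately show False using card_Diff1_less[OF _ that] by simp
  qed
  then show ?thesis using that S by blast
qed

text \<open>A vertex with fewer than k neighbors would leave a free color, which extends the
  coloring of the rest.\<close>

lemma minimal_not_colorable_degree:
  assumes "finite S" "\<not> colorable E S k" "colorable E (S - {v}) k" "v \<in> S"
    and irrefl: "\<And>u. \<not> E u u" and sym: "\<And>u w. E u w \<Longrightarrow> E w u"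
  shows "k \<le> card {u \<in> S. E v u}"
proof (rule ccontr)
  let ?N = "{u \<in> S. E v u}"
  assume "\<not> k \<le> card ?N"
  obtain c where c: "c ` (S - {v}) \<subseteq> {..<k}"
    and proper: "\<And>u w. u \<in> S - {v} \<Longrightarrow> w \<in> S - {v} \<Longrightarrow> E u w \<Longrightarrow> c u \<noteq> c w"
    using colorableE[OF assms(3)] by metis
  have "card (c ` ?N) < card {..<k}"
    using \<open>\<not> k \<le> card ?N\<close> card_image_le[of ?N c] assms(1) by simp
  then have "\<not> {..<k} \<subseteq> c ` ?N" using card_mono[of "c ` ?N" "{..<k}"] assms(1) by auto
  then obtain i where i: "i < k" "i \<notin> c ` ?N" by blast
  have "(c(v := i)) ` S \<subseteq> {..<k}" using c i(1) by auto
  moreover have "(c(v := i)) u \<noteq> (c(v := i)) w" if "u \<in> S" "w \<in> S" "E u w" for u w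
    using that i(2) proper[of u w] irrefl[of u] sym[of u w] by (auto simp: image_iff)
  ultimately show False using assms(2) colorableI by metis
qed

lemma colorable_nonadjacent:
  assumes "colorable E S k" "k < card S"
  obtains p q where "p \<in> S" "q \<in> S" "p \<noteq> q" "\<not> E p q"
proof -
  obtain c where c: "c ` S \<subseteq> {..<k}" and "\<And>u v. u \<in> S \<Longrightarrow> v \<in> S \<Longrightarrow> E u v \<Longrightarrow> c u \<noteq> c v"
    using colorableE[OF assms(1)] by metis
  moreover have "card (c ` S) < card S" using card_mono[OF _ c] assms(2) by simp
  then have "\<not> inj_on c S" by (rule pigeonhole)
  ultimately show ?thesis using that unfolding inj_on_def by blast
qed

text \<open>On k + 2 vertices the degree bound lets each vertex miss at most one other. Deleting a
  vertex leaves k + 1 vertices with k colors, hence a nonadjacent pair; two disjoint such pairs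
  arise, and merging each leaves k color classes.\<close>

lemma minimal_not_colorable_card:
  assumes "finite S" "\<not> colorable E S k" "\<And>v. v \<in> S \<Longrightarrow> colorable E (S - {v}) k"
    and irrefl: "\<And>u. \<not> E u u" and sym: "\<And>u w. E u w \<Longrightarrow> E w u"
  shows "card S \<noteq> k + 2"
proof
  assume card: "card S = k + 2"
  have nonadj: "\<exists>p \<in> S - {v}. \<exists>q \<in> S - {v}. p \<noteq> q \<and> \<not> E p q" if "v \<in> S" for v
  proof -
    have "k < card (S - {v})" using that card assms(1) by simp
    then show ?thesis using colorable_nonadjacent[OF assms(3)[OF that]] by metis
  qed
  have unique: "q = r" if "p \<in> S" "q \<in> S" "r \<in> S" "p \<noteq> q" "p \<noteq> r" "\<not> E p q" "\<not> E p r" for p q r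
  proof (rule ccontr)
    assume "q \<noteq> r"
    have "{u \<in> S. E p u} \<subseteq> S - {p, q, r}" using that irrefl by auto
    then have "card {u \<in> S. E p u} \<le> card (S - {p, q, r})"
      using assms(1) by (intro card_mono) auto
    also have "\<dots> = card S - 3" using that \<open>q \<noteq> r\<close> by (subst card_Diff_subset) auto
    also have "\<dots> < k"
      using card card_mono[of S "{p, q, r}"] that \<open>q \<noteq> r\<close> assms(1) by simp
    finally have "card {u \<in> S. E p u} < k" .
    moreover have "k \<le> card {u \<in> S. E p u}"
      by (intro minimal_not_colorable_degree assms(1,2,3) irrefl that(1)) (rule sym)
    ultimately show False by simp
  qed
  obtain v where "v \<in> S" using card by fastforce
  then obtain p q where pq: "p \<in> S" "q \<in> S" "p \<noteq> q" "\<not> E p q" using nonadj by blast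
  \<comment> \<open>Deleting p gives a second pair that avoids p; it also avoids q, since q misses
    only p.\<close>
  then obtain r t where rt: "r \<in> S - {p}" "t \<in> S - {p}" "r \<noteq> t" "\<not> E r t" using nonadj by blast
  have disj: "r \<noteq> q" "t \<noteq> q" using unique[of q p t] unique[of q p r] pq rt sym by blast+
  \<comment> \<open>Each vertex is its own color, except that q shares the color of p, and t that of
    r.\<close>
  define f where "f x = (if x = q then p else if x = t then r else x)" for x
  have "f ` S = S - {q, t}" unfolding f_def using pq rt disj by auto
  then have "card (f ` S) = k" using card pq rt disj by (simp add: card_Diff_subset)
  moreover have "f u \<noteq> f w" if "E u w" for u w
    using that pq rt irrefl sym unfolding f_def by (auto split: if_splits)
  ultimately show False using colorable_image[of S E f k] assms(1,2) by simp
qed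

lemma card_le_2E:
  assumes "finite S" "card S \<le> 2"
  obtains p q where "S \<subseteq> {p, q}"
proof -
  consider "card S = 0" | "card S = 1" | "card S = 2" using assms(2) by linarith
  then show ?thesis
    by cases (use assms(1) that in \<open>auto simp: card_1_singleton_iff card_2_iff\<close>)
qed

lemma card_le_3E:
  assumes "finite S" "card S \<le> 3"
  obtains p q r where "S \<subseteq> {p, q, r}"
proof (cases "card S = 3")
  case True
  then show ?thesis using that unfolding card_3_iff by blast
next
  case False
  then obtain p q where "S \<subseteq> {p, q}" using card_le_2E[of S] assms by auto
  then show ?thesis using that[of p q q] by blast
qed

lemma card_2_memberE:
  assumes "card S = 2" "a \<in> S"
  obtains c where "S = {a, c}" "c \<noteq> a"
  using assms by (metis card_2_iff insert_commute insert_iff empty_iff)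

section \<open>Cliques and degrees in the graph of middle edges\<close>

context pair_graph
begin

lemma middle_edge_arc: "middle_edge G a b \<Longrightarrow> (a, b) \<in> parcs G"
  unfolding middle_edge_def geodesic3_def by blast

lemma within2_sym: "within2 G u v \<longleftrightarrow> within2 G v u"
  unfolding within2_def using arcs_symmetric by blast

lemma geodesic3_sym: "geodesic3 G x a b y \<longleftrightarrow> geodesic3 G y b a x"
  unfolding geodesic3_def using arcs_symmetric within2_sym by blast

lemma middle_edge_sym: "middle_edge G a b \<Longrightarrow> middle_edge G b a"
  unfolding middle_edge_def using geodesic3_sym by blast

lemma middle_edge_irrefl: "\<not> middle_edge G a a"
  using middle_edge_arc no_loops' by blast

lemma geodesic3D:
  assumes "geodesic3 G x a b y"
  shows "(x, a) \<in> parcs G" "(a, b) \<in> parcs G" "(b, y) \<in> parcs G" "(x, b) \<notin> parcs G"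
    "(a, y) \<notin> parcs G" "(x, y) \<notin> parcs G" "x \<noteq> y" "\<And>w. (x, w) \<in> parcs G \<Longrightarrow> (w, y) \<notin> parcs G"
    "x \<in> pverts G" "a \<in> pverts G" "b \<in> pverts G" "y \<in> pverts G"
  using assms unfolding geodesic3_def within2_def by (auto dest: wellformed')

text \<open>The ends of a geodesic through ab lie outside the clique: x in A would be adjacent to b,
  which is a shortcut, and y is symmetric.\<close>

lemma middle_clique_witness:
  assumes clique: "pairwise (middle_edge G) A"
    and "a \<in> A" "b \<in> A" "a \<noteq> b"
  obtains x y where "x \<in> pverts G - A" "y \<in> pverts G - A" "geodesic3 G x a b y"
proof -
  have outside: "x \<notin> A" if "geodesic3 G x a b y" "b \<in> A" for x a b y
  proof
    assume "x \<in> A"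
    moreover have "x \<noteq> b" using geodesic3D(3,6)[OF that(1)] by blast
    ultimately have "(x, b) \<in> parcs G"
      using clique that(2) middle_edge_arc unfolding pairwise_def by blast
    then show False using geodesic3D(4)[OF that(1)] by blast
  qed
  obtain x y where g: "geodesic3 G x a b y"
    using clique assms(2-4) unfolding middle_edge_def pairwise_def by blast
  moreover have "x \<notin> A" "y \<notin> A"
    using outside[OF g] outside[OF g[unfolded geodesic3_sym[of x]]] assms(2,3) by blast+
  ultimately show ?thesis using that geodesic3D[OF g] by blast
qed

text \<open>The neighborhoods of the vertices of \<open>A\<close> outside \<open>A\<close> form an antichain, and the subsets of
  a set of two or three elements are covered by as many chains.\<close>
lemma middle_clique_card:
  assumes clique: "pairwise (middle_edge G) A"
  shows "card (pverts G - A) \<le> 2 \<Longrightarrow> card A \<le> 2"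
    and "card (pverts G - A) \<le> 3 \<Longrightarrow> card A \<le> 3"
proof -
  have antichain: "\<exists>x \<in> pverts G - A. (x, a) \<in> parcs G \<and> (x, b) \<notin> parcs G"
    if ab: "a \<in> A" "b \<in> A" "a \<noteq> b" for a b
  proof -
    obtain x y where "x \<in> pverts G - A" "geodesic3 G x a b y"
      using middle_clique_witness[OF clique ab] .
    then show ?thesis using geodesic3D(1,4) by blast
  qed
  {
    assume "card (pverts G - A) \<le> 2"
    then obtain p q where "pverts G - A \<subseteq> {p, q}"
      using card_le_2E[of "pverts G - A"] pair_finite_verts by auto
    \<comment> \<open>One chain consists of the sets without p, the other of the sets with
      p.\<close>
    then have "inj_on (\<lambda>a. (p, a) \<in> parcs G) A"
      using antichain unfolding inj_on_def by blast
    then have "card A \<le> card (UNIV :: bool set)" by (rule card_inj_on_le) auto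
    then show "card A \<le> 2" by simp
  next
    assume "card (pverts G - A) \<le> 3"
    then obtain p q r where pqr: "pverts G - A \<subseteq> {p, q, r}"
      using card_le_3E[of "pverts G - A"] pair_finite_verts by auto
    \<comment> \<open>\<open>f\<close> numbers the three chains: 0 for {}, {p}, {p, q}, {p, q, r}; 1
      for {q}, {q, r}; 2 for {r}, {p, r}.\<close>
    define f :: "'a \<Rightarrow> nat" where "f a =
      (if (q, a) \<in> parcs G \<and> (p, a) \<notin> parcs G then 1
       else if (r, a) \<in> parcs G \<and> (q, a) \<notin> parcs G then 2 else 0)" for a
    have "inj_on f A"
    proof (rule inj_onI, rule ccontr)
      fix a b assume ab: "a \<in> A" "b \<in> A" "f a = f b" "a \<noteq> b"
      obtain x where "x \<in> {p, q, r}" "(x, a) \<in> parcs G" "(x, b) \<notin> parcs G"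
        using antichain[OF ab(1,2,4)] pqr by blast
      moreover obtain y where "y \<in> {p, q, r}" "(y, b) \<in> parcs G" "(y, a) \<notin> parcs G"
        using antichain[OF ab(2,1) ab(4)[symmetric]] pqr by blast
      ultimately show False using ab(3) unfolding f_def by (auto split: if_splits)
    qed
    moreover have "f ` A \<subseteq> {0, 1, 2}" unfolding f_def by auto
    ultimately have "card A \<le> card {0, 1, 2 :: nat}" by (intro card_inj_on_le) auto
    then show "card A \<le> 3" by simp
  }
qed

text \<open>Let w be the vertex outside S. A middle edge ab in S has w as an end of its geodesic,
  and w is adjacent to exactly one of a and b, so adjacency to w is a proper coloring.\<close>

lemma colorable_2_if_witness_outside:
  assumes "S \<subseteq> pverts G" "card (pverts G - S) \<le> 1"
    and "\<And>x a b y. geodesic3 G x a b y \<Longrightarrow> a \<in> S \<Longrightarrow> b \<in> S \<Longrightarrow> x \<notin> S \<or> y \<notin> S"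
  shows "colorable (middle_edge G) S 2"
proof -
  have "\<forall>u \<in> pverts G - S. \<forall>v \<in> pverts G - S. u = v"
    using assms(2) card_le_Suc0_iff_eq[of "pverts G - S"] pair_finite_verts by simp
  \<comment> \<open>If S contains every vertex, w is arbitrary, and no middle edge lies in
    S.\<close>
  then obtain w where w: "pverts G - S \<subseteq> {w}" by blast
  show ?thesis
  proof (rule colorable_image[where f = "\<lambda>a. (w, a) \<in> parcs G"])
    show "finite S" using assms(1) pair_finite_verts finite_subset by blast
    show "((w, a) \<in> parcs G) \<noteq> ((w, b) \<in> parcs G)"
      if "a \<in> S" "b \<in> S" "middle_edge G a b" for a b
    proof -
      obtain x y where g: "geodesic3 G x a b y" using \<open>middle_edge G a b\<close>
        unfolding middle_edge_def by blast
      note D = geodesic3D[OF g]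
      have "x = w \<or> y = w" using assms(3)[OF g] that D(9,12) w by blast
      then show ?thesis using D arcs_symmetric by blast
    qed
    have "card ((\<lambda>a. (w, a) \<in> parcs G) ` S) \<le> card (UNIV :: bool set)"
      by (rule card_mono) auto
    then show "card ((\<lambda>a. (w, a) \<in> parcs G) ` S) \<le> 2" by simp
  qed
qed

text \<open>Vertices at distance three are nonadjacent and share no neighbor, so their closed
  neighborhoods are disjoint; the summand 2 counts x and y.\<close>

lemma closed_neighborhoods_card:
  assumes "geodesic3 G x a b y"
  shows "card {u. (x, u) \<in> parcs G} + card {u. (y, u) \<in> parcs G} + 2 \<le> card (pverts G)"
proof -
  let ?X = "{u. (x, u) \<in> parcs G}" and ?Y = "{u. (y, u) \<in> parcs G}"
  note D = geodesic3D[OF assms]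
  have sub: "insert x ?X \<subseteq> pverts G" "insert y ?Y \<subseteq> pverts G"
    using D(9,12) by (auto dest: wellformed'(2))
  have fin: "finite ?X" "finite ?Y" using sub pair_finite_verts by (auto intro: finite_subset)
  have "x \<notin> ?X" "y \<notin> ?Y" by (auto dest: no_loops')
  then have "card ?X + card ?Y + 2 = card (insert x ?X) + card (insert y ?Y)" using fin by simp
  also have "\<dots> = card (insert x ?X \<union> insert y ?Y)"
  proof (rule card_Un_disjoint[symmetric])
    show "insert x ?X \<inter> insert y ?Y = {}"
      using D(6,7,8) by (auto dest: arcs_symmetric)
  qed (use fin in auto)
  also have "\<dots> \<le> card (pverts G)" using sub by (intro card_mono pair_finite_verts) blast
  finally show ?thesis .
qed

text \<open>A minimal set has minimum degree at least k, so more than k vertices, and not k + 2.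
  With k + 1 vertices it is a clique; with k + 3 or more at most one vertex is left outside.\<close>

lemma minimal_middle_set_cases:
  assumes "\<not> colorable (middle_edge G) (pverts G) k" "card (pverts G) \<le> k + 4"
  obtains
    (clique) A where "A \<subseteq> pverts G" "card A = k + 1"
      "pairwise (middle_edge G) A"
  | (large) S where "S \<subseteq> pverts G" "\<not> colorable (middle_edge G) S k" "card (pverts G - S) \<le> 1"
      "\<And>v. v \<in> S \<Longrightarrow> k \<le> card {u \<in> S. middle_edge G v u}"
proof -
  obtain S where S: "S \<subseteq> pverts G" "\<not> colorable (middle_edge G) S k"
    and min: "\<And>v. v \<in> S \<Longrightarrow> colorable (middle_edge G) (S - {v}) k"
    using minimal_not_colorable[OF pair_finite_verts assms(1)] by metis
  have fin: "finite S" using S(1) pair_finite_verts finite_subset by blast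
  have deg: "k \<le> card {u \<in> S. middle_edge G v u}" if "v \<in> S" for v
    by (intro minimal_not_colorable_degree fin S(2) min that middle_edge_irrefl)
      (rule middle_edge_sym)
  have nbrs: "{u \<in> S. middle_edge G v u} \<subseteq> S - {v}" for v using middle_edge_irrefl by blast
  have ge: "card S \<ge> k + 1"
  proof -
    have "S \<noteq> {}" using S(2) unfolding colorable_def by auto
    then obtain v where "v \<in> S" by blast
    then have "k \<le> card (S - {v})"
      using deg[OF \<open>v \<in> S\<close>] card_mono[OF _ nbrs[of v]] fin by fastforce
    moreover have "card S > 0" using \<open>v \<in> S\<close> fin card_gt_0_iff by blast
    ultimately show ?thesis using \<open>v \<in> S\<close> fin by simp
  qed
  have "card S \<noteq> k + 2"
    by (rule minimal_not_colorable_card[OF fin S(2) min middle_edge_irrefl middle_edge_sym])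
  with ge consider "card S = k + 1" | "card S \<ge> k + 3" by linarith
  then show ?thesis
  proof cases
    case 1
    have "middle_edge G a b" if "a \<in> S" "b \<in> S" "a \<noteq> b" for a b
    proof -
      have "card (S - {a}) \<le> card {u \<in> S. middle_edge G a u}" using 1 that deg fin by simp
      then have "{u \<in> S. middle_edge G a u} = S - {a}"
        by (intro card_seteq nbrs) (use fin in auto)
      then show ?thesis using that by blast
    qed
    then show ?thesis using clique S(1) 1 unfolding pairwise_def by blast
  next
    case 2
    then have "card (pverts G - S) \<le> 1" using S(1) fin assms(2) by (simp add: card_Diff_subset)
    then show ?thesis using large S deg by blast
  qed
qed

text \<open>A clique of size k + 1 leaves at most three vertices outside, and at most two if
  \<open>card (pverts G) \<le> k + 3\<close>, against the antichain bounds. A large set has minimum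
  degree at least k, so a geodesic with both ends in it would need 2 (k + 1) vertices.\<close>

lemma middle_edge_colorable:
  assumes "2 \<le> k" "card (pverts G) \<le> k + 4" "card (pverts G) < 2 * (k + 1)"
    and "card (pverts G) \<le> k + 3 \<or> 3 \<le> k"
  shows "colorable (middle_edge G) (pverts G) k"
proof (rule ccontr)
  assume "\<not> ?thesis"
  then show False using assms(2)
  proof (cases rule: minimal_middle_set_cases)
    case (clique A)
    have "card (pverts G - A) = card (pverts G) - (k + 1)"
      using clique(1,2) pair_finite_verts by (metis card_Diff_subset finite_subset)
    then show False
      using middle_clique_card[OF clique(3)] assms clique(2) by linarith
  next
    case (large S)
    have "x \<notin> S \<or> y \<notin> S" if g: "geodesic3 G x a b y" for x a b y
    proof (rule ccontr)
      assume xy: "\<not> (x \<notin> S \<or> y \<notin> S)"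
      have "k \<le> card {u. (v, u) \<in> parcs G}" if "v \<in> S" for v
      proof -
        have "finite {u. (v, u) \<in> parcs G}"
          using pair_finite_verts wellformed' by (auto intro: finite_subset)
        then have "card {u \<in> S. middle_edge G v u} \<le> card {u. (v, u) \<in> parcs G}"
          using middle_edge_arc by (intro card_mono) auto
        then show ?thesis using large(4)[OF that] by linarith
      qed
      from this[of x] this[of y] show False
        using closed_neighborhoods_card[OF g] xy assms(3) by simp
    qed
    then have "colorable (middle_edge G) S 2"
      using colorable_2_if_witness_outside[OF large(1,3)] by blast
    then show False using colorable_mono assms(1) large(2) by blast
  qed
qed

text \<open>For n = 6 and k = 2 the count of closed neighborhoods is tight: if the ends x and y are
  in S, they have degree exactly two, and their closed neighborhoods exhaust the graph.\<close>

lemma six_vertices_colorable_or_clique: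
  assumes "card (pverts G) = 6"
  obtains "colorable (middle_edge G) (pverts G) 2"
  | A where "A \<subseteq> pverts G" "card A = 3" "pairwise (middle_edge G) A"
proof (cases "colorable (middle_edge G) (pverts G) 2")
  case False
  moreover have "card (pverts G) \<le> 2 + 4" using assms by simp
  ultimately show ?thesis
  proof (cases rule: minimal_middle_set_cases)
    case (large S)
    have "\<exists>x a b y. geodesic3 G x a b y \<and> x \<in> S \<and> a \<in> S \<and> b \<in> S \<and> y \<in> S"
      using colorable_2_if_witness_outside[OF large(1,3)] large(2) by blast
    then obtain x a b y where g: "geodesic3 G x a b y" and S: "x \<in> S" "a \<in> S" "b \<in> S" "y \<in> S"
      by blast
    note D = geodesic3D[OF g]
    let ?N = "\<lambda>v. {u. (v, u) \<in> parcs G}" and ?H = "\<lambda>v. {u \<in> S. middle_edge G v u}"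
    have fin: "finite (?N v)" for v
      by (rule finite_subset[OF _ pair_finite_verts]) (auto dest: wellformed')
    have sub: "?H v \<subseteq> ?N v" for v using middle_edge_arc by blast
    have le: "2 \<le> card (?N v)" if "v \<in> S" for v
      using large(4)[OF that] card_mono[OF fin sub, of v] by linarith
    have N2: "card (?N x) = 2" "card (?N y) = 2"
      using closed_neighborhoods_card[OF g] le[OF S(1)] le[OF S(4)] assms by linarith+
    \<comment> \<open>Two middle edges already meet at x and at y, so every edge there is a middle
      edge.\<close>
    have eqH: "?H x = ?N x" "?H y = ?N y"
      using card_seteq[OF fin sub] large(4) S(1,4) N2 by auto
    obtain c where c: "?N x = {a, c}" "c \<noteq> a"
      using card_2_memberE[OF N2(1), of a] D(1) by blast
    have "(y, b) \<in> parcs G" using D(3) arcs_symmetric by blast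
    then obtain d where d: "?N y = {b, d}" "d \<noteq> b"
      using card_2_memberE[OF N2(2), of b] by blast
    have xa: "middle_edge G x a" and yb: "middle_edge G y b" using eqH c(1) d(1) by blast+
    \<comment> \<open>A geodesic with middle edge xa enters x from its other neighbor c, and an edge
      ac would shorten it.\<close>
    have ac: "(a, c) \<notin> parcs G"
    proof -
      obtain x' y' where g': "geodesic3 G x' x a y'" using xa unfolding middle_edge_def by blast
      note D' = geodesic3D[OF g']
      have "x' \<in> ?N x" using D'(1) arcs_symmetric by blast
      moreover have "x' \<noteq> a" using D'(3,6) by blast
      ultimately show ?thesis using D'(4) c arcs_symmetric by blast
    qed
    have bd: "(b, d) \<notin> parcs G"
    proof -
      obtain x' y' where g': "geodesic3 G x' y b y'" using yb unfolding middle_edge_def by blast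
      note D' = geodesic3D[OF g']
      have "x' \<in> ?N y" using D'(1) arcs_symmetric by blast
      moreover have "x' \<noteq> b" using D'(3,6) by blast
      ultimately show ?thesis using D'(4) d arcs_symmetric by blast
    qed
    have V: "pverts G = {x, y, a, b, c, d}"
    proof (rule card_seteq[symmetric])
      have "(x, c) \<in> parcs G" "(y, d) \<in> parcs G" using c d by blast+
      moreover from this have "c \<notin> {x, y, b, d}" "d \<notin> {x, y, a, c}"
        using D no_loops' arcs_symmetric d c by blast+
      ultimately have "card {x, y, a, b, c, d} = 6"
        using D c d no_loops' by (auto simp: card_insert_if)
      then show "card (pverts G) \<le> card {x, y, a, b, c, d}" using assms by simp
      show "{x, y, a, b, c, d} \<subseteq> pverts G"
        using D \<open>(x, c) \<in> parcs G\<close> \<open>(y, d) \<in> parcs G\<close> by (auto dest: wellformed')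
    qed (rule pair_finite_verts)
    text \<open>Only the six-cycle remains, and it is bipartite.\<close>
    have "colorable (middle_edge G) (pverts G) 2"
    proof (rule colorable_image[where f = "\<lambda>v. v \<in> {x, b, d}"])
      have xd: "(x, d) \<notin> parcs G" and yc: "(y, c) \<notin> parcs G"
        using D(8) c d arcs_symmetric by blast+
      have no: "(u, v) \<notin> parcs G" if "u \<in> {x, b, d} \<and> v \<in> {x, b, d} \<or> u \<in> {y, a, c} \<and> v \<in> {y, a, c}"
        for u v
        using that xd yc ac bd D(4,5) no_loops' by (auto dest: arcs_symmetric)
      show "(u \<in> {x, b, d}) \<noteq> (v \<in> {x, b, d})"
        if "u \<in> pverts G" "v \<in> pverts G" "middle_edge G u v" for u v
        using no[of u v] middle_edge_arc[OF that(3)] that(1,2) unfolding V by blast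
      have "card ((\<lambda>v. v \<in> {x, b, d}) ` pverts G) \<le> card (UNIV :: bool set)"
        by (rule card_mono) auto
      then show "card ((\<lambda>v. v \<in> {x, b, d}) ` pverts G) \<le> 2" by simp
    qed (rule pair_finite_verts)
    then show ?thesis using False by blast
  next
    case (clique A)
    then show ?thesis using that(2)[of A] by simp
  qed
qed (use that in blast)

end

section \<open>Graphs of small order\<close>

context pair_graph
begin

section \<open>Isomorphisms with explicitly listed graphs\<close>

text \<open>The isomorphism sends \<open>vs ! i\<close> to i. By symmetry and absence of loops the
  pairs i < j are enough, so for a concrete graph the check is an evaluation.\<close>

lemma digraph_isoI:
  assumes "distinct vs" "length vs = m" "set vs = pverts G"
    and "\<forall>e \<in> set es. fst e < m \<and> snd e < m \<and> fst e \<noteq> snd e"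
    and edges: "\<forall>j < m. \<forall>i < j.
      (vs ! i, vs ! j) \<in> parcs G \<longleftrightarrow> (i, j) \<in> set es \<or> (j, i) \<in> set es"
  shows "digraph_iso (with_proj G) (with_proj (graph_of_edges m es))"
proof -
  have all_edges: "(vs ! i, vs ! j) \<in> parcs G \<longleftrightarrow> (i, j) \<in> set es \<or> (j, i) \<in> set es"
    if "i < m" "j < m" for i j
  proof -
    consider "i < j" | "j < i" | "i = j" by linarith
    then show ?thesis
    proof cases
      case 1
      then show ?thesis using edges that by simp
    next
      case 2
      then show ?thesis by (subst arc_sym) (use edges that in auto)
    next
      case 3
      then show ?thesis using assms(4) no_loops' by fastforce
    qed
  qed
  define g where "g = the_inv_into {..<m} ((!) vs)"
  have inj: "inj_on ((!) vs) {..<m}" using assms(1,2) by (auto simp: inj_on_def nth_eq_iff_index_eq)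
  have g: "g (vs ! i) = i" if "i < m" for i
    using the_inv_into_f_f[OF inj] that unfolding g_def by simp
  have V: "pverts G = (!) vs ` {..<m}" using assms(2,3) by (auto simp: set_conv_nth)
  let ?f = "\<lparr>iso_verts = g, iso_arcs = map_prod g g, iso_head = snd, iso_tail = fst\<rparr>"
  have ginj: "inj_on g (pverts G)" unfolding V by (auto simp: inj_on_def g)
  have "inj_on (map_prod g g) (parcs G)"
    by (rule inj_on_subset[OF map_prod_inj_on[OF ginj ginj]]) (auto dest: wellformed')
  then have iso: "digraph_isomorphism ?f"
    using ginj unfolding digraph_isomorphism_def by (auto simp: wf_digraph_axioms)
  have arcs: "map_prod g g ` parcs G = set es \<union> (set es)\<inverse>"
  proof (intro equalityI subsetI)
    fix e assume "e \<in> map_prod g g ` parcs G"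
    then obtain u v where uv: "e = (g u, g v)" "(u, v) \<in> parcs G" by auto
    then obtain i j where "u = vs ! i" "v = vs ! j" "i < m" "j < m"
      using wellformed'[OF uv(2)] unfolding V by blast
    then show "e \<in> set es \<union> (set es)\<inverse>" using uv all_edges g by auto
  next
    fix e assume e: "e \<in> set es \<union> (set es)\<inverse>"
    obtain i j where ij: "e = (i, j)" by fastforce
    then have "i < m" "j < m" using assms(4) e by auto
    moreover from this have "(vs ! i, vs ! j) \<in> parcs G" using all_edges e ij by auto
    ultimately show "e \<in> map_prod g g ` parcs G" using ij g by (force intro: rev_image_eqI)
  qed
  have "g ` pverts G = {..<m}" unfolding V using g by (auto simp: image_image)
  then have "with_proj (graph_of_edges m es) = app_iso ?f (with_proj G)"
    using arcs by (simp add: app_iso_def graph_of_edges_def with_proj_def)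
  then show ?thesis using iso unfolding digraph_iso_def by blast
qed

text \<open>Listing the preimages of the numbers below m turns the arc set into an explicit list, on
  which adjacency can be evaluated.\<close>

lemma digraph_isoE:
  assumes "digraph_iso (with_proj G) (with_proj (graph_of_edges m es))"
  obtains vs where "distinct vs" "length vs = m" "pverts G = set vs"
    "parcs G = set (map (\<lambda>(i, j). (vs ! i, vs ! j)) (es @ map prod.swap es))"
proof -
  let ?H = "graph_of_edges m es"
  obtain f where f: "digraph_isomorphism f" "with_proj ?H = app_iso f (with_proj G)"
    using assms unfolding digraph_iso_def by blast
  define g where "g = iso_verts f"
  have inj: "inj_on g (pverts G)" using f(1) unfolding digraph_isomorphism_def g_def by simp
  have im: "g ` pverts G = {..<m}"
    using arg_cong[OF f(2), of verts] by (simp add: g_def graph_of_edges_def)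
  have arcs: "(\<lambda>(u, v). (g u, g v)) ` parcs G = set es \<union> (set es)\<inverse>"
    using arg_cong[OF f(2), of arcs_ends] arcs_ends_app_iso_eq[OF f(1)]
    by (simp add: g_def graph_of_edges_def)
  define h where "h = the_inv_into (pverts G) g"
  have h: "h (g u) = u" if "u \<in> pverts G" for u
    using the_inv_into_f_f[OF inj that] unfolding h_def .
  have him: "h ` {..<m} = pverts G" unfolding im[symmetric] using h by (auto simp: image_image)
  have hinj: "inj_on h {..<m}"
    unfolding h_def im[symmetric] by (rule inj_on_the_inv_into[OF inj])
  define vs where "vs = map h [0..<m]"
  show thesis
  proof
    show "distinct vs" using hinj unfolding vs_def by (simp add: distinct_map atLeast0LessThan)
    show "length vs = m" unfolding vs_def by simp
    show "pverts G = set vs" using him unfolding vs_def by (simp add: atLeast0LessThan)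
    have "(\<lambda>(i, j). (vs ! i, vs ! j)) ` (set es \<union> (set es)\<inverse>) =
        (\<lambda>(u, v). (vs ! g u, vs ! g v)) ` parcs G"
      unfolding arcs[symmetric] by (simp add: image_image case_prod_unfold)
    also have "\<dots> = (\<lambda>e. e) ` parcs G"
    proof (rule image_cong[OF refl])
      fix e assume "e \<in> parcs G"
      moreover obtain u v where "e = (u, v)" by fastforce
      moreover have "vs ! g u = u" if "u \<in> pverts G" for u
        proof -
        have "g u < m" using im that by blast
        then show ?thesis using h[OF that] unfolding vs_def by simp
      qed
      ultimately show "(case e of (u, v) \<Rightarrow> (vs ! g u, vs ! g v)) = e"
        using wellformed'[of u v] by simp
    qed
    also have "set es \<union> (set es)\<inverse> = set (es @ map prod.swap es)" by force
    finally show "parcs G = set (map (\<lambda>(i, j). (vs ! i, vs ! j)) (es @ map prod.swap es))"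
      unfolding set_map by simp
  qed
qed

section \<open>Recognizing the extremal graphs\<close>

text \<open>The ends of geodesics through the three middle edges are among the three vertices
  outside the triangle. They fit together: each triangle vertex has a private neighbor there, and
  these are pairwise at distance three.\<close>

lemma middle_triangle_net:
  assumes "card (pverts G) = 6" "A \<subseteq> pverts G" "card A = 3" "pairwise (middle_edge G) A"
  shows "digraph_iso (with_proj G) (with_proj net)"
proof -
  obtain a1 a2 a3 where A: "A = {a1, a2, a3}" "a1 \<noteq> a2" "a1 \<noteq> a3" "a2 \<noteq> a3"
    using assms(3) unfolding card_3_iff by blast
  let ?O = "pverts G - A"
  have "finite A" using A(1) by simp
  then have O3: "card ?O = 3" using assms(1-3) by (simp add: card_Diff_subset)
  obtain x y where xy: "x \<in> ?O" "y \<in> ?O" and g12: "geodesic3 G x a1 a2 y"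
    using middle_clique_witness[OF assms(4), of a1 a2] A by blast
  obtain x' y' where x'y': "x' \<in> ?O" "y' \<in> ?O" and g13: "geodesic3 G x' a1 a3 y'"
    using middle_clique_witness[OF assms(4), of a1 a3] A by blast
  obtain x'' y'' where x''y'': "x'' \<in> ?O" "y'' \<in> ?O" and g23: "geodesic3 G x'' a2 a3 y''"
    using middle_clique_witness[OF assms(4), of a2 a3] A by blast
  note D12 = geodesic3D[OF g12] and D13 = geodesic3D[OF g13] and D23 = geodesic3D[OF g23]
  have "card (?O - {x, y}) = 1" using O3 xy D12(7) pair_finite_verts by (simp add: card_Diff_subset)
  then obtain z where "?O - {x, y} = {z}" by (auto simp: card_1_singleton_iff)
  then have O: "?O = {x, y, z}" and z: "z \<noteq> x" "z \<noteq> y" using xy by blast+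
  have ne: "x' \<noteq> y" "y' \<noteq> x" "x'' \<noteq> x" "y'' \<noteq> y"
    using D12 D13 D23 arcs_symmetric by blast+
  \<comment> \<open>If y' were y, then y'' would be x, and a3 would be a common neighbor of x and
    y.\<close>
  have y': "y' = z"
  proof (rule ccontr)
    assume "y' \<noteq> z"
    then have "y' = y" using ne x'y' O by blast
    then have "x'' = z" "y'' = x \<or> y'' = z" using D13 D23 ne x''y'' O arcs_symmetric by blast+
    then have "y'' = x" using D23(7) by blast
    then show False using \<open>y' = y\<close> D23(3) D13(3) D12(8) arcs_symmetric by blast
  qed
  then have x': "x' = x" using x'y' ne O D13(7) by blast
  have "y'' \<noteq> x" using arcs_symmetric[OF D23(3)] D13(4) x' by blast
  then have y'': "y'' = z" using ne x''y'' O by blast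
  then have x'': "x'' = y" using x''y'' ne O D23(7) by blast
  have arcs: "(a1, a2) \<in> parcs G" "(a2, a3) \<in> parcs G" "(a3, a1) \<in> parcs G"
    "(a1, x) \<in> parcs G" "(a2, y) \<in> parcs G" "(a3, z) \<in> parcs G"
    using D12 D13 D23 y' arcs_symmetric by blast+
  have no: "(a1, y) \<notin> parcs G" "(a1, z) \<notin> parcs G" "(a2, x) \<notin> parcs G" "(a2, z) \<notin> parcs G"
    "(a3, x) \<notin> parcs G" "(a3, y) \<notin> parcs G" "(x, y) \<notin> parcs G" "(x, z) \<notin> parcs G" "(y, z) \<notin> parcs G"
    using D12 D13 D23 y' x' y'' x'' arcs_symmetric by blast+
  have V: "pverts G = {a1, a2, a3, x, y, z}" using O assms(2) A(1) by blast
  show ?thesis unfolding net_def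
  proof (rule digraph_isoI[of "[a1, a2, a3, x, y, z]"])
    show "distinct [a1, a2, a3, x, y, z]" using A O z D12(7) by auto
    show "set [a1, a2, a3, x, y, z] = pverts G" using V by simp
    show "\<forall>j<6. \<forall>i<j.
      ([a1, a2, a3, x, y, z] ! i, [a1, a2, a3, x, y, z] ! j) \<in> parcs G \<longleftrightarrow>
      (i, j) \<in> set [(0, 1), (1, 2), (2, 0), (0, 3), (1, 4), (2, 5)] \<or>
      (j, i) \<in> set [(0, 1), (1, 2), (2, 0), (0, 3), (1, 4), (2, 5)]"
      using arcs no arc_sym[of a3 a1] by (simp add: eval_nat_numeral All_less_Suc)
  qed auto
qed

text \<open>Nonadjacent u and v have a common neighbor w. The fourth vertex z is within distance two
  of both, so it is adjacent to w or to both u and v; these five patterns give four graphs.\<close>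

lemma four_vertices:
  assumes "card (pverts G) = 4" "\<And>u v. u \<in> pverts G \<Longrightarrow> v \<in> pverts G \<Longrightarrow> within2 G u v"
    and "u \<in> pverts G" "v \<in> pverts G" "u \<noteq> v" "(u, v) \<notin> parcs G"
  shows "\<exists>H \<in> {K13, C4, paw, diamond}. digraph_iso (with_proj G) (with_proj H)"
proof -
  obtain w where w: "(u, w) \<in> parcs G" "(w, v) \<in> parcs G"
    using assms(2)[OF assms(3,4)] assms(5,6) unfolding within2_def by blast
  have d: "w \<noteq> u" "w \<noteq> v" "w \<in> pverts G" using w no_loops' wellformed' by blast+
  have "card (pverts G - {u, v, w}) = 1"
    using assms(1,3-5) d pair_finite_verts by (simp add: card_Diff_subset)
  then obtain z where "pverts G - {u, v, w} = {z}" by (auto simp: card_1_singleton_iff)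
  then have V: "pverts G = {u, v, w, z}" and z: "z \<noteq> u" "z \<noteq> v" "z \<noteq> w"
    using assms(3,4) d by blast+
  have sym: "(v, u) \<notin> parcs G" "(w, u) \<in> parcs G" "(v, w) \<in> parcs G"
    using assms(6) w arcs_symmetric by blast+
  have zu: "(z, u) \<in> parcs G \<or> (z, w) \<in> parcs G" "(z, v) \<in> parcs G \<or> (z, w) \<in> parcs G"
    using assms(2)[of z u] assms(2)[of z v] z sym wellformed' no_loops' assms(6) unfolding within2_def V
    by blast+
  note facts = w sym assms(5,6) d z V
  consider "(z, u) \<in> parcs G" "(z, v) \<in> parcs G" "(z, w) \<notin> parcs G"
    | "(z, u) \<in> parcs G" "(z, v) \<in> parcs G" "(z, w) \<in> parcs G"
    | "(z, u) \<notin> parcs G" "(z, v) \<notin> parcs G" "(z, w) \<in> parcs G"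
    | "(z, u) \<in> parcs G" "(z, v) \<notin> parcs G" "(z, w) \<in> parcs G"
    | "(z, u) \<notin> parcs G" "(z, v) \<in> parcs G" "(z, w) \<in> parcs G"
    using zu by blast
  then show ?thesis
  proof cases
    case 1
    then have "digraph_iso G C4" unfolding C4_def
      using facts 1[unfolded arc_sym[of z]]
      by (intro digraph_isoI[of "[u, w, v, z]"]) (auto simp: eval_nat_numeral All_less_Suc)
    then show ?thesis by blast
  next
    case 2
    then have "digraph_iso G diamond" unfolding diamond_def
      using facts 2[unfolded arc_sym[of z]]
      by (intro digraph_isoI[of "[w, u, z, v]"]) (auto simp: eval_nat_numeral All_less_Suc)
    then show ?thesis by blast
  next
    case 3
    then have "digraph_iso G K13" unfolding K13_def
      using facts 3[unfolded arc_sym[of z]]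
      by (intro digraph_isoI[of "[w, u, v, z]"]) (auto simp: eval_nat_numeral All_less_Suc)
    then show ?thesis by blast
  next
    case 4
    then have "digraph_iso G paw" unfolding paw_def
      using facts 4[unfolded arc_sym[of z]]
      by (intro digraph_isoI[of "[w, u, z, v]"]) (auto simp: eval_nat_numeral All_less_Suc)
    then show ?thesis by blast
  next
    case 5
    then have "digraph_iso G paw" unfolding paw_def
      using facts 5[unfolded arc_sym[of z]]
      by (intro digraph_isoI[of "[w, v, z, u]"]) (auto simp: eval_nat_numeral All_less_Suc)
    then show ?thesis by blast
  qed
qed

lemma connected_ex_arc:
  assumes "connected G" "u \<in> pverts G" "v \<in> pverts G" "u \<noteq> v"
  obtains w where "(u, w) \<in> parcs G"
proof -
  obtain p where "geodesic G u p v" using geodesic_exists assms(1-3) .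
  then have "awalk u p v" by (auto simp: geodesic_iff apath_def)
  then show ?thesis using that assms(4) by (cases p) (auto simp: awalk_simps)
qed

text \<open>The induced path x a b y has one further vertex z. Connectivity gives z a neighbor, and
  distance three forbids adjacency to both x and y; up to reversing the path, the eleven remaining
  patterns are six graphs.\<close>

lemma five_vertices:
  assumes "connected G" "card (pverts G) = 5" "geodesic3 G x a b y"
  shows "\<exists>H \<in> {P5, fork, bull, lollipop, banner, kite}. digraph_iso (with_proj G) (with_proj H)"
proof -
  note D = geodesic3D[OF assms(3)]
  have sym: "(a, x) \<in> parcs G" "(b, a) \<in> parcs G" "(y, b) \<in> parcs G" "(b, x) \<notin> parcs G"
    "(y, a) \<notin> parcs G" "(y, x) \<notin> parcs G"
    using D arcs_symmetric by blast+
  have ne: "x \<noteq> a" "a \<noteq> b" "b \<noteq> y" "x \<noteq> b" "a \<noteq> y"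
    using D(1-6) no_loops' by blast+
  have "card (pverts G - {x, a, b, y}) = 1"
    using assms(2) D(7,9-12) ne pair_finite_verts by (simp add: card_Diff_subset)
  then obtain z where "pverts G - {x, a, b, y} = {z}" by (auto simp: card_1_singleton_iff)
  then have V: "pverts G = {x, a, b, y, z}" and z: "z \<noteq> x" "z \<noteq> a" "z \<noteq> b" "z \<noteq> y"
    using D(9-12) by blast+
  obtain w where "(z, w) \<in> parcs G" using connected_ex_arc[OF assms(1), of z x] z V by blast
  then have "w \<in> {x, a, b, y}" "(w, z) \<in> parcs G"
    using wellformed'(2)[of z w] V no_loops'[of z w] arcs_symmetric[of z w] by auto
  then have "(x, z) \<in> parcs G \<or> (a, z) \<in> parcs G \<or> (b, z) \<in> parcs G \<or> (y, z) \<in> parcs G"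
    by auto
  moreover have "(x, z) \<notin> parcs G \<or> (y, z) \<notin> parcs G" using D(8) arcs_symmetric by blast
  ultimately consider
      "(x, z) \<in> parcs G" "(a, z) \<notin> parcs G" "(b, z) \<notin> parcs G" "(y, z) \<notin> parcs G"
    | "(x, z) \<notin> parcs G" "(a, z) \<notin> parcs G" "(b, z) \<notin> parcs G" "(y, z) \<in> parcs G"
    | "(x, z) \<notin> parcs G" "(a, z) \<in> parcs G" "(b, z) \<notin> parcs G" "(y, z) \<notin> parcs G"
    | "(x, z) \<notin> parcs G" "(a, z) \<notin> parcs G" "(b, z) \<in> parcs G" "(y, z) \<notin> parcs G"
    | "(x, z) \<in> parcs G" "(a, z) \<in> parcs G" "(b, z) \<notin> parcs G" "(y, z) \<notin> parcs G"
    | "(x, z) \<notin> parcs G" "(a, z) \<notin> parcs G" "(b, z) \<in> parcs G" "(y, z) \<in> parcs G"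
    | "(x, z) \<in> parcs G" "(a, z) \<notin> parcs G" "(b, z) \<in> parcs G" "(y, z) \<notin> parcs G"
    | "(x, z) \<notin> parcs G" "(a, z) \<in> parcs G" "(b, z) \<notin> parcs G" "(y, z) \<in> parcs G"
    | "(x, z) \<notin> parcs G" "(a, z) \<in> parcs G" "(b, z) \<in> parcs G" "(y, z) \<notin> parcs G"
    | "(x, z) \<in> parcs G" "(a, z) \<in> parcs G" "(b, z) \<in> parcs G" "(y, z) \<notin> parcs G"
    | "(x, z) \<notin> parcs G" "(a, z) \<in> parcs G" "(b, z) \<in> parcs G" "(y, z) \<in> parcs G"
    by argo
  then show ?thesis
  proof cases
    case 1
    then have "digraph_iso G P5" unfolding P5_def
      using D(1-7) sym ne z V 1[unfolded arc_sym[of _ z]]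
      by (intro digraph_isoI[of "[z, x, a, b, y]"]) (auto simp: eval_nat_numeral All_less_Suc)
    then show ?thesis by blast
  next
    case 2
    then have "digraph_iso G P5" unfolding P5_def
      using D(1-7) sym ne z V 2[unfolded arc_sym[of _ z]]
      by (intro digraph_isoI[of "[x, a, b, y, z]"]) (auto simp: eval_nat_numeral All_less_Suc)
    then show ?thesis by blast
  next
    case 3
    then have "digraph_iso G fork" unfolding fork_def
      using D(1-7) sym ne z V 3[unfolded arc_sym[of _ z]]
      by (intro digraph_isoI[of "[a, x, z, b, y]"]) (auto simp: eval_nat_numeral All_less_Suc)
    then show ?thesis by blast
  next
    case 4
    then have "digraph_iso G fork" unfolding fork_def
      using D(1-7) sym ne z V 4[unfolded arc_sym[of _ z]]
      by (intro digraph_isoI[of "[b, y, z, a, x]"]) (auto simp: eval_nat_numeral All_less_Suc)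
    then show ?thesis by blast
  next
    case 5
    then have "digraph_iso G lollipop" unfolding lollipop_def
      using D(1-7) sym ne z V 5[unfolded arc_sym[of _ z]]
      by (intro digraph_isoI[of "[a, x, z, b, y]"]) (auto simp: eval_nat_numeral All_less_Suc)
    then show ?thesis by blast
  next
    case 6
    then have "digraph_iso G lollipop" unfolding lollipop_def
      using D(1-7) sym ne z V 6[unfolded arc_sym[of _ z]]
      by (intro digraph_isoI[of "[b, y, z, a, x]"]) (auto simp: eval_nat_numeral All_less_Suc)
    then show ?thesis by blast
  next
    case 7
    then have "digraph_iso G banner" unfolding banner_def
      using D(1-7) sym ne z V 7[unfolded arc_sym[of _ z]]
      by (intro digraph_isoI[of "[b, a, x, z, y]"]) (auto simp: eval_nat_numeral All_less_Suc)
    then show ?thesis by blast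
  next
    case 8
    then have "digraph_iso G banner" unfolding banner_def
      using D(1-7) sym ne z V 8[unfolded arc_sym[of _ z]]
      by (intro digraph_isoI[of "[a, b, y, z, x]"]) (auto simp: eval_nat_numeral All_less_Suc)
    then show ?thesis by blast
  next
    case 9
    then have "digraph_iso G bull" unfolding bull_def
      using D(1-7) sym ne z V 9[unfolded arc_sym[of _ z]]
      by (intro digraph_isoI[of "[a, b, z, x, y]"]) (auto simp: eval_nat_numeral All_less_Suc)
    then show ?thesis by blast
  next
    case 10
    then have "digraph_iso G kite" unfolding kite_def
      using D(1-7) sym ne z V 10[unfolded arc_sym[of _ z]]
      by (intro digraph_isoI[of "[a, b, z, x, y]"]) (auto simp: eval_nat_numeral All_less_Suc)
    then show ?thesis by blast
  next
    case 11
    then have "digraph_iso G kite" unfolding kite_def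
      using D(1-7) sym ne z V 11[unfolded arc_sym[of _ z]]
      by (intro digraph_isoI[of "[b, a, z, y, x]"]) (auto simp: eval_nat_numeral All_less_Suc)
    then show ?thesis by blast
  qed
qed

lemma three_vertices:
  assumes "card (pverts G) = 3"
    and "\<And>u v. u \<in> pverts G \<Longrightarrow> v \<in> pverts G \<Longrightarrow> u \<noteq> v \<Longrightarrow> (u, v) \<in> parcs G"
  shows "digraph_iso (with_proj G) (with_proj K3)"
proof -
  obtain a b c where V: "pverts G = {a, b, c}" "a \<noteq> b" "a \<noteq> c" "b \<noteq> c"
    using assms(1) unfolding card_3_iff by blast
  then have "(a, b) \<in> parcs G" "(a, c) \<in> parcs G" "(b, c) \<in> parcs G" using assms(2) by blast+
  then show ?thesis unfolding K3_def
    using V by (intro digraph_isoI[of "[a, b, c]"]) (auto simp: eval_nat_numeral All_less_Suc)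
qed

section \<open>Properties of the listed graphs that determine their values\<close>

lemma K3_complete:
  assumes "digraph_iso (with_proj G) (with_proj K3)"
  shows "card (pverts G) = 3"
    and "\<forall>u \<in> pverts G. \<forall>v \<in> pverts G. u \<noteq> v \<longrightarrow> (u, v) \<in> parcs G"
proof -
  let ?es = "[(0,1), (1,2), (2,0)] :: (nat \<times> nat) list"
  obtain vs where vs: "distinct vs" "length vs = 3" "pverts G = set vs"
    "parcs G = set (map (\<lambda>(i, j). (vs ! i, vs ! j)) (?es @ map prod.swap ?es))"
    using digraph_isoE[OF assms[unfolded K3_def]] .
  show "card (pverts G) = 3" using vs(1-3) distinct_card by metis
  obtain a b c where "vs = [a, b, c]" using vs(2) by (auto simp: eval_nat_numeral length_Suc_conv)
  then show "\<forall>u \<in> pverts G. \<forall>v \<in> pverts G. u \<noteq> v \<longrightarrow> (u, v) \<in> parcs G"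
    unfolding vs(3,4) by auto
qed

lemma diameter_2_graphs:
  assumes "H \<in> {K13, C4, paw, diamond}" "digraph_iso (with_proj G) (with_proj H)"
  shows "card (pverts G) = 4"
    and "\<forall>u \<in> pverts G. \<forall>v \<in> pverts G. within2 G u v"
    and "\<exists>u \<in> pverts G. \<exists>v \<in> pverts G. u \<noteq> v \<and> (u, v) \<notin> parcs G"
proof -
  \<comment> \<open>Collecting the edge lists lets each claim be evaluated in all four graphs at
    once.\<close>
  let ?E = "{[(0,1), (0,2), (0,3)], [(0,1), (1,2), (2,3), (3,0)], [(0,1), (1,2), (2,0), (0,3)],
    [(0,1), (0,2), (0,3), (1,2), (2,3)]} :: (nat \<times> nat) list set"
  obtain es where es: "es \<in> ?E" "H = graph_of_edges 4 es"
    using assms(1) by (auto simp: K13_def C4_def paw_def diamond_def)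
  obtain vs where vs: "distinct vs" "length vs = 4" "pverts G = set vs"
    "parcs G = set (map (\<lambda>(i, j). (vs ! i, vs ! j)) (es @ map prod.swap es))"
    using digraph_isoE[OF assms(2)[unfolded es(2)]] .
  show "card (pverts G) = 4" using vs(1-3) distinct_card by metis
  obtain a b c d where v: "vs = [a, b, c, d]"
    using vs(2) by (auto simp: eval_nat_numeral length_Suc_conv)
  show "\<forall>u \<in> pverts G. \<forall>v \<in> pverts G. within2 G u v"
    using es(1) vs(1) unfolding within2_Bex vs(3,4) v by (elim insertE emptyE) simp_all
  show "\<exists>u \<in> pverts G. \<exists>v \<in> pverts G. u \<noteq> v \<and> (u, v) \<notin> parcs G"
    using es(1) vs(1) unfolding vs(3,4) v by (elim insertE emptyE) auto
qed

text \<open>A single pair farther apart than two excludes one color; two colors suffice on five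
  vertices by \<open>middle_edge_colorable\<close>.\<close>

lemma diameter_3_graphs:
  assumes "H \<in> {P5, fork, bull, lollipop, banner, kite}" "digraph_iso (with_proj G) (with_proj H)"
  shows "card (pverts G) = 5"
    and "\<exists>u \<in> pverts G. \<exists>v \<in> pverts G. \<not> within2 G u v"
proof -
  \<comment> \<open>Each edge list comes with the positions of two vertices at distance
    three.\<close>
  let ?E = "{([(0,1), (1,2), (2,3), (3,4)], 0, 3), ([(0,1), (0,2), (0,3), (3,4)], 1, 4),
    ([(0,1), (1,2), (2,0), (0,3), (1,4)], 3, 4), ([(0,1), (1,2), (2,0), (0,3), (3,4)], 1, 4),
    ([(0,1), (1,2), (2,3), (3,0), (0,4)], 2, 4), ([(0,1), (0,2), (0,3), (1,2), (2,3), (1,4)], 3, 4)}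
    :: ((nat \<times> nat) list \<times> nat \<times> nat) set"
  obtain es i j where es: "(es, i, j) \<in> ?E" "H = graph_of_edges 5 es"
    using assms(1) unfolding P5_def fork_def bull_def lollipop_def banner_def kite_def by blast
  obtain vs where vs: "distinct vs" "length vs = 5" "pverts G = set vs"
    "parcs G = set (map (\<lambda>(i, j). (vs ! i, vs ! j)) (es @ map prod.swap es))"
    using digraph_isoE[OF assms(2)[unfolded es(2)]] .
  show "card (pverts G) = 5" using vs(1-3) distinct_card by metis
  obtain a b c d e where v: "vs = [a, b, c, d, e]"
    using vs(2) by (auto simp: eval_nat_numeral length_Suc_conv)
  have "i < 5" "j < 5" using es(1) by auto
  then have "vs ! i \<in> pverts G" "vs ! j \<in> pverts G" using vs(2,3) by auto
  moreover have "\<not> within2 G (vs ! i) (vs ! j)"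
    using es(1) vs(1) unfolding within2_Bex vs(4) v by (elim insertE emptyE) auto
  ultimately show "\<exists>u \<in> pverts G. \<exists>v \<in> pverts G. \<not> within2 G u v" by blast
qed

text \<open>The geodesic between two pendant vertices is unique, so the triangle needs three colors.\<close>
lemma net_spvc:
  assumes "connected G" "digraph_iso (with_proj G) (with_proj net)"
  shows "card (pverts G) = 6" "3 \<le> spvc G"
proof -
  let ?es = "[(0,1), (1,2), (2,0), (0,3), (1,4), (2,5)] :: (nat \<times> nat) list"
  obtain vs where vs: "distinct vs" "length vs = 6" "pverts G = set vs"
    "parcs G = set (map (\<lambda>(i, j). (vs ! i, vs ! j)) (?es @ map prod.swap ?es))"
    using digraph_isoE[OF assms(2)[unfolded net_def]] .
  show "card (pverts G) = 6" using vs(1-3) distinct_card by metis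
  obtain a b c x y z where v: "vs = [a, b, c, x, y, z]"
    using vs(2) by (auto simp: eval_nat_numeral length_Suc_conv)
  have P: "parcs G = {(a, b), (b, a), (b, c), (c, b), (c, a), (a, c), (a, x), (x, a), (b, y), (y, b),
    (c, z), (z, c)}"
    unfolding vs(4) v by auto
  have dist: "distinct [a, b, c, x, y, z]" using vs(1) v by simp
  have V: "pverts G = {a, b, c, x, y, z}" using vs(3) v by simp
  have g: "geodesic3 G x a b y" "geodesic3 G y b c z" "geodesic3 G x a c z"
    unfolding geodesic3_def within2_Bex P using dist by auto
  have uniq: "a' = a \<and> b' = b" if "geodesic3 G x a' b' y" for a' b'
    using that dist unfolding geodesic3_def P by auto
  have uniq': "a' = b \<and> b' = c" if "geodesic3 G y a' b' z" for a' b'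
    using that dist unfolding geodesic3_def P by auto
  have uniq'': "a' = a \<and> b' = c" if "geodesic3 G x a' b' z" for a' b'
    using that dist unfolding geodesic3_def P by auto
  obtain col where col: "num_colors G col = spvc G" "strong_proper_vertex_connected G col"
    using spvc_attained[OF assms(1)] by metis
  show "3 \<le> spvc G"
  proof (cases col)
    case None
    \<comment> \<open>Without colors the graph would be complete, although x and y are at distance
      three.\<close>
    then have "(x, y) \<in> parcs G"
      using col(1) spvc_eq_0_iff[OF assms(1)] V dist by simp
    then show ?thesis using geodesic3D(6)[OF g(1)] by blast
  next
    case (Some k)
    note neq = geodesic3_color_neq[OF col(2)[unfolded Some]]
    have "k a \<noteq> k b" "k b \<noteq> k c" "k a \<noteq> k c"
      using neq[OF g(1)] neq[OF g(2)] neq[OF g(3)] uniq uniq' uniq'' by metis+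
    then have "3 = card (k ` {a, b, c})" by simp
    also have "\<dots> \<le> card (k ` pverts G)"
      using V by (intro card_mono finite_imageI pair_finite_verts) auto
    finally show ?thesis using col(1) Some by simp
  qed
qed

end

theorem theorem7:
  fixes G :: "'a pair_pre_digraph" and n :: nat
  assumes "pair_graph G"
    and "connected (with_proj G)"
    and "card (pverts G) = n"
    and "n \<ge> 2"
  shows "int (spvc G) = int n - 3 \<longleftrightarrow>
    (\<exists>H \<in> {K3, K13, C4, paw, diamond, P5, fork, bull, lollipop, banner, kite, net}.
       digraph_iso (with_proj G) (with_proj H))"
proof
  interpret pair_graph G by fact
  note conn = assms(2)
  let ?iso = "\<lambda>\<H>. \<exists>H \<in> \<H>. digraph_iso (with_proj G) (with_proj H)"
  {
    assume "int (spvc G) = int n - 3"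
    \<comment> \<open>The integer equation excludes n = 2, so \<open>n - 3\<close> is exact on the
      natural numbers.\<close>
    then have spvc: "spvc G = n - 3" "3 \<le> n" by linarith+
    have "n \<le> 6"
    proof (rule ccontr)
      assume "\<not> n \<le> 6"
      \<comment> \<open>For k = n - 4 the condition n < 2 (k + 1) reads n > 6.\<close>
      then have "colorable (middle_edge G) (pverts G) (n - 4)"
        using assms(3) by (intro middle_edge_colorable) auto
      then show False using spvc_le_colorable[OF conn] spvc \<open>\<not> n \<le> 6\<close> by fastforce
    qed
    then consider "n = 3" | "n = 4" | "n = 5" | "n = 6" using spvc(2) by linarith
    then show "?iso {K3, K13, C4, paw, diamond, P5, fork, bull, lollipop, banner, kite, net}"
    proof cases
      case 1
      then have "digraph_iso G K3"
        using three_vertices spvc_eq_0_iff[OF conn] spvc assms(3) by auto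
      then show ?thesis by blast
    next
      case 2
      then have w: "\<forall>u \<in> pverts G. \<forall>v \<in> pverts G. within2 G u v"
        using spvc_le_1_iff[OF conn] spvc by simp
      obtain u v where "u \<in> pverts G" "v \<in> pverts G" "u \<noteq> v" "(u, v) \<notin> parcs G"
        using spvc_eq_0_iff[OF conn] spvc 2 by auto
      then have "?iso {K13, C4, paw, diamond}" using four_vertices w assms(3) 2 by blast
      then show ?thesis by blast
    next
      case 3
      then obtain u v where "u \<in> pverts G" "v \<in> pverts G" "\<not> within2 G u v"
        using spvc_le_1_iff[OF conn] spvc by auto
      then obtain a b y where "geodesic3 G u a b y" using ex_geodesic3[OF conn] by blast
      then have "?iso {P5, fork, bull, lollipop, banner, kite}"
        using five_vertices[OF conn] assms(3) 3 by blast
      then show ?thesis by blast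
    next
      case 4
      then have "card (pverts G) = 6" using assms(3) by simp
      then have "digraph_iso G net"
      proof (cases rule: six_vertices_colorable_or_clique)
        case 1
        then show ?thesis using spvc_le_colorable[OF conn] spvc 4 by fastforce
      next
        case (2 A)
        then show ?thesis using middle_triangle_net \<open>card (pverts G) = 6\<close> by blast
      qed
      then show ?thesis by blast
    qed
  next
    assume "?iso {K3, K13, C4, paw, diamond, P5, fork, bull, lollipop, banner, kite, net}"
    then consider "digraph_iso G K3" | "?iso {K13, C4, paw, diamond}"
      | "?iso {P5, fork, bull, lollipop, banner, kite}" | "digraph_iso G net"
      by blast
    then show "int (spvc G) = int n - 3"
    proof cases
      case 1
      then show ?thesis using K3_complete spvc_eq_0_iff[OF conn] assms(3) by simp
    next
      case 2
      then obtain H where H: "H \<in> {K13, C4, paw, diamond}" "digraph_iso G H" by blast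
      have "spvc G \<le> 1" using diameter_2_graphs(2)[OF H] spvc_le_1_iff[OF conn] by blast
      moreover have "spvc G \<noteq> 0" using diameter_2_graphs(3)[OF H] spvc_eq_0_iff[OF conn] by blast
      ultimately show ?thesis using diameter_2_graphs(1)[OF H] assms(3) by linarith
    next
      case 3
      then obtain H where H: "H \<in> {P5, fork, bull, lollipop, banner, kite}" "digraph_iso G H" by blast
      note card = diameter_3_graphs(1)[OF H]
      have "\<not> spvc G \<le> 1" using diameter_3_graphs(2)[OF H] spvc_le_1_iff[OF conn] by blast
      \<comment> \<open>Here n = 5 = k + 3 with k = 2, and 5 < 2 (k + 1).\<close>
      moreover have "spvc G \<le> 2"
        by (intro spvc_le_colorable conn middle_edge_colorable) (use card in auto)
      ultimately show ?thesis using card assms(3) by linarith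
    next
      case 4
      note net = net_spvc[OF conn 4]
      \<comment> \<open>Here n = 6 = k + 3 with k = 3; the pendant vertices give the matching lower
        bound.\<close>
      have "spvc G \<le> 3"
        by (intro spvc_le_colorable conn middle_edge_colorable) (use net(1) in auto)
      then show ?thesis using net assms(3) by linarith
    qed
  }
qed

end
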